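(* Let $\Upsilon$ be a tree. If $\rho:\Upsilon\longrightarrow Z$ is an increasing function that is not constant on any ever-branching subset of $\Upsilon$, then $\Upsilon$ does not contain any ever-branching Baire subsets.
   Context: Trees. A tree is a partially ordered set $(\Upsilon,\preccurlyeq)$ such that for each $t\in\Upsilon$ the set of predecessors $\{s\in\Upsilon : s\preccurlyeq t\}$ is well-ordered. Throughout, all trees are assumed to have the property that every non-empty linearly ordered subset has at most one minimal upper bound. For $t\in\Upsilon$, the wedge is $[t,\infty)=\{u\in\Upsilon : t\preccurlyeq u\}$. Baire subsets. The forcing topology on $\Upsilon$ has as a basis the set of all wedges $[t,\infty)$, $t\in\Upsilon$. A subset $B\subseteq\Upsilon$ is called Baire if it is a Baire space with respect to the induced forcing topology, i.e. any countable intersection of relatively dense, open subsets of $B$ is dense in $B$. When referring to the Baire property, only subsets that are perfect with respect to the forcing topology (without isolated points, equivalently without maximal elements) are considered. Ever-branching. A (non-empty) subset $E$ of a tree is ever-branching if each element of $E$ has a pair of strict successors in $E$ that are incomparable in the tree order. Increasing maps. A map $\rho:P\to Q$ between partial orders is increasing if $\rho(s)\preccurlyeq\rho(t)$ whenever $s\prec t$. The order $Z$. Let $\omega_1$ be the first uncountable ordinal. $Z$ is the set of all increasing (i.e. non-decreasing), continuous transfinite sequences $x=(x_\xi)_{\xi\leq\beta}$ of real numbers, where $0\leq\beta<\omega_1$, such that $x$ is strictly increasing on $[0,\beta)$. It is linearly ordered by: $x<y$ if and only if either $y$ strictly extends $x$, or there is an ordinal $\alpha$ such that $x_\xi=y_\xi$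 for $\xi<\alpha$ and $y_\alpha<x_\alpha$. *)

theory Defs
  imports "HOL-Analysis.Analysis" "HOL-Library.Countable_Set_Type"
begin

section \<open>Trees and the forcing topology\<close>

definition minimal_upper_bound :: "'a::order set \<Rightarrow> 'a set \<Rightarrow> 'a \<Rightarrow> bool" where
  "minimal_upper_bound T C u \<longleftrightarrow>
     u \<in> T \<and> (\<forall>c\<in>C. c \<le> u) \<and> \<not> (\<exists>v\<in>T. (\<forall>c\<in>C. c \<le> v) \<and> v < u)"

text \<open>A tree is a set \<open>T\<close> with the order inherited from an ambient type.\<close>

definition tree :: "'a::order set \<Rightarrow> bool" where
  "tree T \<longleftrightarrow>
     (\<forall>t\<in>T. well_order_on {s\<in>T. s \<le> t}
               {(r, s). r \<in> T \<and> s \<in> T \<and> r \<le> s \<and> s \<le> t}) \<and>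
     (\<forall>C\<subseteq>T. C \<noteq> {} \<and> Complete_Partial_Order.chain (\<le>) C \<longrightarrow>
               (\<exists>\<^sub>\<le>\<^sub>1 u. minimal_upper_bound T C u))"

definition wedge :: "'a::order set \<Rightarrow> 'a \<Rightarrow> 'a set" where
  "wedge T t = {u\<in>T. t \<le> u}"

definition forcing_topology :: "'a::order set \<Rightarrow> 'a topology" where
  "forcing_topology T = topology (arbitrary union_of (\<lambda>W. W \<in> wedge T ` T))"

lemma openin_forcing_topology:
  "openin (forcing_topology T) = arbitrary union_of (\<lambda>W. W \<in> wedge T ` T)"
proof -
  have "(arbitrary union_of (\<lambda>W. W \<in> wedge T ` T)) (U \<inter> V)"
    if "U \<in> wedge T ` T" "V \<in> wedge T ` T" for U V
  proof -
    have "\<exists>W\<in>wedge T ` T. t \<in> W \<and> W \<subseteq> U \<inter> V" if "t \<in> U \<inter> V" for t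
      using that \<open>U \<in> _\<close> \<open>V \<in> _\<close>
      by (intro bexI[of _ "wedge T t"]) (auto simp: wedge_def)
    then show ?thesis
      unfolding arbitrary_union_of_alt by blast
  qed
  then show ?thesis
    unfolding forcing_topology_def
    by (intro topology_inverse') (auto simp: istopology_base_eq)
qed

lemma topspace_forcing_topology [simp]: "topspace (forcing_topology T) = T"
proof
  show "topspace (forcing_topology T) \<subseteq> T"
    using openin_topspace[of "forcing_topology T"]
    unfolding openin_forcing_topology arbitrary_union_of_alt by (fastforce simp: wedge_def)
  have "openin (forcing_topology T) T"
    unfolding openin_forcing_topology arbitrary_union_of_alt
  proof
    fix t assume "t \<in> T"
    then show "\<exists>W. W \<in> wedge T ` T \<and> t \<in> W \<and> W \<subseteq> T"
      by (intro exI[of _ "wedge T t"]) (auto simp: wedge_def)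
  qed
  then show "T \<subseteq> topspace (forcing_topology T)"
    by (rule openin_subset)
qed

definition Baire_space :: "'a topology \<Rightarrow> bool" where
  "Baire_space X \<longleftrightarrow>
     (\<forall>\<G>. countable \<G> \<and> (\<forall>G\<in>\<G>. openin X G \<and> X closure_of G = topspace X) \<longrightarrow>
          X closure_of (topspace X \<inter> \<Inter>\<G>) = topspace X)"

text \<open>The second conjunct of \<open>Baire_subset\<close> says that \<open>B\<close> has no isolated points.\<close>

definition Baire_subset :: "'a::order set \<Rightarrow> 'a set \<Rightarrow> bool" where
  "Baire_subset T B \<longleftrightarrow>
     B \<subseteq> T \<and> B \<subseteq> forcing_topology T derived_set_of B \<and>
     Baire_space (subtopology (forcing_topology T) B)"

definition ever_branching :: "'a::order set \<Rightarrow> bool" where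
  "ever_branching E \<longleftrightarrow>
     E \<noteq> {} \<and> (\<forall>t\<in>E. \<exists>u\<in>E. \<exists>v\<in>E. t < u \<and> t < v \<and> \<not> u \<le> v \<and> \<not> v \<le> u)"


section \<open>Countable ordinals\<close>

text \<open>The elements of the type \<open>omega1\<close>, with its order, are the ordinals below \<open>\<omega>\<^sub>1\<close>:
  it is uncountable and well-ordered, and all its proper initial segments are countable.\<close>

lemma Card_order_omega1: "Card_order (cardSuc natLeq)"
  by (rule cardSuc_Card_order[OF natLeq_Card_order])

lemma Well_order_omega1: "Well_order (cardSuc natLeq)"
  by (rule card_order_on_well_order_on[OF Card_order_omega1])

typedef omega1 = "Field (cardSuc natLeq)"
proof -
  have "infinite (Field (cardSuc natLeq))"
    using cardSuc_finite[OF natLeq_Card_order] by (simp add: Field_natLeq)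
  then show ?thesis
    by (metis ex_in_conv finite.emptyI)
qed

instantiation omega1 :: linorder
begin

definition less_eq_omega1 :: "omega1 \<Rightarrow> omega1 \<Rightarrow> bool" where
  "a \<le> b \<longleftrightarrow> (Rep_omega1 a, Rep_omega1 b) \<in> cardSuc natLeq"

definition less_omega1 :: "omega1 \<Rightarrow> omega1 \<Rightarrow> bool" where
  "(a :: omega1) < b \<longleftrightarrow> a \<le> b \<and> \<not> b \<le> a"

instance
proof
  have W: "refl_on (Field (cardSuc natLeq)) (cardSuc natLeq)" "trans (cardSuc natLeq)"
    "antisym (cardSuc natLeq)" "total_on (Field (cardSuc natLeq)) (cardSuc natLeq)"
    using Well_order_omega1 by (auto simp: order_on_defs)
  fix a b c :: omega1
  show "a < b \<longleftrightarrow> a \<le> b \<and> \<not> b \<le> a"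
    by (rule less_omega1_def)
  show refl: "a \<le> a"
    unfolding less_eq_omega1_def using W(1) Rep_omega1 by (auto dest: refl_onD)
  show "a \<le> b \<Longrightarrow> b \<le> c \<Longrightarrow> a \<le> c"
    unfolding less_eq_omega1_def using W(2) by (auto dest: transD)
  show "a \<le> b \<Longrightarrow> b \<le> a \<Longrightarrow> a = b"
    unfolding less_eq_omega1_def using W(3) by (auto dest: antisymD simp: Rep_omega1_inject)
  show "a \<le> b \<or> b \<le> a"
  proof (cases "a = b")
    case False
    then show ?thesis
      unfolding less_eq_omega1_def
      using W(4) Rep_omega1[of a] Rep_omega1[of b]
      by (auto simp: total_on_def Rep_omega1_inject)
  qed (use refl in simp)
qed

end

instantiation omega1 :: linorder_topology
begin

definition open_omega1 :: "omega1 set \<Rightarrow> bool" where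
  "open_omega1 = generate_topology (range (\<lambda>a. {..<a}) \<union> range (\<lambda>a. {a<..}))"

instance
  by intro_classes (rule open_omega1_def)

end

lemma less_omega1_iff:
  "a < b \<longleftrightarrow> (Rep_omega1 a, Rep_omega1 b) \<in> cardSuc natLeq - Id"
  unfolding less_le by (auto simp: less_eq_omega1_def Rep_omega1_inject)

instance omega1 :: wellorder
proof
  fix P :: "omega1 \<Rightarrow> bool" and a :: omega1
  assume step: "\<And>x. (\<And>y. y < x \<Longrightarrow> P y) \<Longrightarrow> P x"
  have "wf (inv_image (cardSuc natLeq - Id) Rep_omega1)"
    using Well_order_omega1 by (auto simp: well_order_on_def intro: wf_inv_image)
  then show "P a"
    by (induction a rule: wf_induct_rule) (rule step, simp add: less_omega1_iff in_inv_image)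
qed

lemma uncountable_UNIV_omega1:
  includes cardinal_syntax
  shows "uncountable (UNIV :: omega1 set)"
proof
  assume "countable (UNIV :: omega1 set)"
  then have "countable (range Rep_omega1)"
    by simp
  then have "|Field (cardSuc natLeq)| \<le>o natLeq"
    by (metis type_definition.Rep_range[OF type_definition_omega1] countable_card_le_natLeq)
  then have "cardSuc natLeq \<le>o natLeq"
    using card_of_Field_ordIso[OF Card_order_omega1] ordIso_ordLeq_trans ordIso_symmetric by blast
  then show False
    using cardSuc_greater[OF natLeq_Card_order] not_ordLess_ordLeq by blast
qed

lemma countable_lessThan_omega1:
  includes cardinal_syntax
  shows "countable {..<a :: omega1}"
proof -
  have "Rep_omega1 ` {..<a} \<subseteq> underS (cardSuc natLeq) (Rep_omega1 a)"
    by (auto simp: less_omega1_iff underS_def)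
  moreover have "|underS (cardSuc natLeq) (Rep_omega1 a)| <o cardSuc natLeq"
    by (rule card_of_underS[OF Card_order_omega1 Rep_omega1])
  then have "|underS (cardSuc natLeq) (Rep_omega1 a)| \<le>o natLeq"
    using cardSuc_ordLess_ordLeq cardSuc_ordLeq_ordLess[OF natLeq_Card_order card_of_Card_order]
    by blast
  then have "countable (underS (cardSuc natLeq) (Rep_omega1 a))"
    by (simp add: countable_card_le_natLeq)
  ultimately have "countable (Rep_omega1 ` {..<a})"
    using countable_subset by blast
  then show ?thesis
    by (rule countable_image_inj_on) (simp add: inj_on_def Rep_omega1_inject)
qed


section \<open>The linear order Z\<close>

text \<open>The pair \<open>(\<beta>, x)\<close> encodes the sequence of the \<open>x \<xi>\<close> for \<open>\<xi> \<le> \<beta>\<close>; the values of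
  \<open>x\<close> beyond \<open>\<beta>\<close> are fixed by extensionality. Continuity refers to the order topology.\<close>

typedef Z = "{(\<beta> :: omega1, x :: omega1 \<Rightarrow> real).
    x \<in> extensional {..\<beta>} \<and> mono_on {..\<beta>} x \<and> continuous_on {..\<beta>} x \<and>
    strict_mono_on {..<\<beta>} x}"
proof -
  define b :: omega1 where "b = (LEAST b. True)"
  have b: "b \<le> c" for c
    unfolding b_def by (simp add: Least_le)
  then have [simp]: "c \<le> b \<longleftrightarrow> c = b" "\<not> c < b" for c
    by (auto intro: antisym simp: not_less)
  then have "{..b} = {b}"
    by auto
  then have "continuous_on {..b} (restrict (\<lambda>_. 0 :: real) {..b})"
    by simp
  then show ?thesis
    by (intro exI[of _ "(b, restrict (\<lambda>_. 0) {..b})"])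
      (simp add: mono_on_def strict_mono_on_def)
qed

definition last_index :: "Z \<Rightarrow> omega1" where
  "last_index x = fst (Rep_Z x)"

definition entry :: "Z \<Rightarrow> omega1 \<Rightarrow> real" where
  "entry x = snd (Rep_Z x)"

definition strictly_extends :: "Z \<Rightarrow> Z \<Rightarrow> bool" where
  "strictly_extends y x \<longleftrightarrow>
     last_index x < last_index y \<and> (\<forall>\<xi>\<le>last_index x. entry x \<xi> = entry y \<xi>)"

lemma Z_eqI:
  assumes "last_index x = last_index y" "\<And>\<xi>. \<xi> \<le> last_index x \<Longrightarrow> entry x \<xi> = entry y \<xi>"
  shows "x = y"
proof -
  have "entry z \<in> extensional {..last_index z}" for z
    using Rep_Z[of z] by (auto simp: entry_def last_index_def)
  then have "entry x = entry y"
    by (metis assms atMost_iff extensionalityI)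
  then show ?thesis
    using assms(1) by (simp add: entry_def last_index_def prod_eq_iff flip: Rep_Z_inject)
qed

instantiation Z :: linorder
begin

definition less_Z :: "Z \<Rightarrow> Z \<Rightarrow> bool" where
  "x < y \<longleftrightarrow> strictly_extends y x \<or>
     (\<exists>\<alpha>. \<alpha> \<le> last_index x \<and> \<alpha> \<le> last_index y \<and>
          (\<forall>\<xi><\<alpha>. entry x \<xi> = entry y \<xi>) \<and> entry y \<alpha> < entry x \<alpha>)"

definition less_eq_Z :: "Z \<Rightarrow> Z \<Rightarrow> bool" where
  "(x :: Z) \<le> y \<longleftrightarrow> x < y \<or> x = y"

instance
proof
  have irrefl: "\<not> x < x" for x :: Z
    by (auto simp: less_Z_def strictly_extends_def)
  have trans: "x < z" if less: "x < y" "y < z" for x y z :: Z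
  proof -
    consider "strictly_extends y x" "strictly_extends z y"
      | \<alpha> where "strictly_extends y x" "\<alpha> \<le> last_index y" "\<alpha> \<le> last_index z"
          "\<forall>\<xi><\<alpha>. entry y \<xi> = entry z \<xi>" "entry z \<alpha> < entry y \<alpha>"
      | \<alpha> where "strictly_extends z y" "\<alpha> \<le> last_index x" "\<alpha> \<le> last_index y"
          "\<forall>\<xi><\<alpha>. entry x \<xi> = entry y \<xi>" "entry y \<alpha> < entry x \<alpha>"
      | \<alpha> \<beta> where "\<alpha> \<le> last_index x" "\<alpha> \<le> last_index y"
          "\<forall>\<xi><\<alpha>. entry x \<xi> = entry y \<xi>" "entry y \<alpha> < entry x \<alpha>"
          "\<beta> \<le> last_index y" "\<beta> \<le> last_index z"
          "\<forall>\<xi><\<beta>. entry y \<xi> = entry z \<xi>" "entry z \<beta> < entry y \<beta>"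
      using less unfolding less_Z_def by blast
    then show ?thesis
    proof cases
      case 1
      then have "strictly_extends z x"
        by (auto simp: strictly_extends_def)
      then show ?thesis
        by (simp add: less_Z_def)
    next
      case 2
      show ?thesis
      proof (cases "\<alpha> \<le> last_index x")
        case True
        with 2 show ?thesis
          unfolding less_Z_def by (intro disjI2 exI[of _ \<alpha>]) (auto simp: strictly_extends_def)
      next
        case False
        with 2 have "strictly_extends z x"
          by (auto simp: strictly_extends_def)
        then show ?thesis
          by (simp add: less_Z_def)
      qed
    next
      case 3
      then show ?thesis
        unfolding less_Z_def by (intro disjI2 exI[of _ \<alpha>]) (auto simp: strictly_extends_def)
    next
      case 4
      consider "\<alpha> < \<beta>" | "\<beta> < \<alpha>" | "\<alpha> = \<beta>"
        by (rule linorder_cases)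
      then show ?thesis
      proof cases
        case 1
        with 4 show ?thesis
          unfolding less_Z_def by (intro disjI2 exI[of _ \<alpha>]) auto
      next
        case 2
        with 4 show ?thesis
          unfolding less_Z_def by (intro disjI2 exI[of _ \<beta>]) auto
      next
        case 3
        with 4 show ?thesis
          unfolding less_Z_def by (intro disjI2 exI[of _ \<alpha>]) auto
      qed
    qed
  qed
  have total: "x < y \<or> x = y \<or> y < x" for x y :: Z
  proof (cases "\<exists>\<xi>. \<xi> \<le> last_index x \<and> \<xi> \<le> last_index y \<and> entry x \<xi> \<noteq> entry y \<xi>")
    case True
    define \<alpha> where
      "\<alpha> = (LEAST \<xi>. \<xi> \<le> last_index x \<and> \<xi> \<le> last_index y \<and> entry x \<xi> \<noteq> entry y \<xi>)"
    have \<alpha>: "\<alpha> \<le> last_index x" "\<alpha> \<le> last_index y" "entry x \<alpha> \<noteq> entry y \<alpha>"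
      using LeastI_ex[OF True] by (auto simp: \<alpha>_def)
    have eq: "\<forall>\<xi><\<alpha>. entry x \<xi> = entry y \<xi>"
    proof (intro allI impI)
      fix \<xi> assume "\<xi> < \<alpha>"
      with \<alpha>(1,2) have "\<xi> \<le> last_index x" "\<xi> \<le> last_index y"
        by auto
      with not_less_Least[OF \<open>\<xi> < \<alpha>\<close>[unfolded \<alpha>_def]] show "entry x \<xi> = entry y \<xi>"
        by blast
    qed
    consider "entry x \<alpha> < entry y \<alpha>" | "entry y \<alpha> < entry x \<alpha>"
      using \<alpha>(3) by linarith
    then show ?thesis
    proof cases
      case 1
      then have "y < x"
        unfolding less_Z_def using \<alpha> eq by (intro disjI2 exI[of _ \<alpha>]) auto
      then show ?thesis by simp
    next
      case 2
      then have "x < y"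
        unfolding less_Z_def using \<alpha> eq by (intro disjI2 exI[of _ \<alpha>]) auto
      then show ?thesis by simp
    qed
  next
    case False
    consider "last_index x < last_index y" | "last_index y < last_index x"
      | "last_index x = last_index y"
      by (rule linorder_cases)
    then show ?thesis
    proof cases
      case 1
      with False have "strictly_extends y x"
        by (auto simp: strictly_extends_def)
      then show ?thesis by (simp add: less_Z_def)
    next
      case 2
      with False have "strictly_extends x y"
        by (auto simp: strictly_extends_def)
      then show ?thesis by (simp add: less_Z_def)
    next
      case 3
      with False have "x = y"
        by (intro Z_eqI) auto
      then show ?thesis by simp
    qed
  qed
  fix x y z :: Z
  show "x < y \<longleftrightarrow> x \<le> y \<and> \<not> y \<le> x"
    using irrefl trans by (auto simp: less_eq_Z_def)
  show "x \<le> x"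
    by (simp add: less_eq_Z_def)
  show "x \<le> y \<Longrightarrow> y \<le> z \<Longrightarrow> x \<le> z"
    using trans by (auto simp: less_eq_Z_def)
  show "x \<le> y \<Longrightarrow> y \<le> x \<Longrightarrow> x = y"
    using irrefl trans by (auto simp: less_eq_Z_def)
  show "x \<le> y \<or> y \<le> x"
    using total by (auto simp: less_eq_Z_def)
qed

end

end

theory Submission
  imports Defs
begin

text \<open>Let \<open>B\<close> be an ever-branching Baire subset of \<open>T\<close>. The trace on \<open>B\<close> of each wedge
  \<open>[t, \<infinity>)\<close> with \<open>t \<in> B\<close> is itself ever-branching, so above every point of \<open>B\<close> the map \<open>\<rho>\<close>
  takes a strictly larger value.
  The order of \<open>Z\<close> is lexicographic with the reals reversed, so once the entries below \<open>\<alpha>\<close>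
  no longer change, the entry at \<open>\<alpha>\<close> can only decrease along \<open>B\<close>, and a weakly decreasing real
  function on a Baire subset is constant above the points of a dense open set
  (\<open>dense_open_eventually_const\<close>). By induction on \<open>\<alpha> < \<omega>\<^sub>1\<close>, densely many points of
  \<open>B\<close> settle the entries up to \<open>\<alpha>\<close> for good (\<open>dense_open_settled\<close>). A branch through all
  these sets would carry a strictly increasing \<open>\<omega>\<^sub>1\<close>-sequence of reals. There need not be such a
  branch, but the Baire property is enough: a single \<open>u \<in> B\<close> decides, for all rationals \<open>q\<close>
  at once, whether settled entries ever exceed \<open>q\<close>, and if so at which index one has done so.
  These countably many indices are bounded by some \<open>\<alpha>\<close>, and a point above \<open>u\<close> that settles
  entries beyond \<open>\<alpha>\<close> exceeds a rational too late.\<close>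

section \<open>Dense open sets in the forcing topology\<close>

text \<open>The dense open subsets of \<open>B\<close> in order-theoretic terms: relatively open means upward closed,
  and dense means cofinal.\<close>

definition dense_open :: "'a::order set \<Rightarrow> 'a set \<Rightarrow> bool" where
  "dense_open B D \<longleftrightarrow>
     D \<subseteq> B \<and> (\<forall>u\<in>D. \<forall>v\<in>B. u \<le> v \<longrightarrow> v \<in> D) \<and> (\<forall>t\<in>B. \<exists>u\<in>D. t \<le> u)"

lemma dense_openI:
  assumes "D \<subseteq> B" "\<And>u v. u \<in> D \<Longrightarrow> v \<in> B \<Longrightarrow> u \<le> v \<Longrightarrow> v \<in> D" "\<And>t. t \<in> B \<Longrightarrow> \<exists>u\<in>D. t \<le> u"
  shows "dense_open B D"
  using assms unfolding dense_open_def by blast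

lemma dense_open_subset: "dense_open B D \<Longrightarrow> D \<subseteq> B"
  by (auto simp: dense_open_def)

lemma dense_open_up: "dense_open B D \<Longrightarrow> u \<in> D \<Longrightarrow> v \<in> B \<Longrightarrow> u \<le> v \<Longrightarrow> v \<in> D"
  unfolding dense_open_def by blast

lemma dense_openE:
  assumes "dense_open B D" "t \<in> B"
  obtains u where "u \<in> D" "t \<le> u"
  using assms unfolding dense_open_def by blast

lemma openin_wedge: "t \<in> T \<Longrightarrow> openin (forcing_topology T) (wedge T t)"
  unfolding openin_forcing_topology arbitrary_union_of_alt by blast

lemma openin_forcing_topology_up:
  assumes "openin (forcing_topology T) U" "t \<in> U" "t \<le> u" "u \<in> T"
  shows "u \<in> U"
proof -
  from assms(1,2) obtain W where "W \<in> wedge T ` T" "t \<in> W" "W \<subseteq> U"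
    unfolding openin_forcing_topology arbitrary_union_of_alt by blast
  with assms(3,4) show ?thesis
    by (auto simp: wedge_def dest: order_trans)
qed

lemma
  assumes "B \<subseteq> T" "dense_open B D"
  shows openin_dense_open: "openin (subtopology (forcing_topology T) B) D"
    and closure_of_dense_open: "subtopology (forcing_topology T) B closure_of D = B"
proof -
  have "openin (forcing_topology T) (\<Union>t\<in>D. wedge T t)"
    using assms dense_open_subset by (blast intro: openin_wedge)
  moreover have "D = (\<Union>t\<in>D. wedge T t) \<inter> B"
    using assms dense_open_subset[OF assms(2)]
    by (auto simp: wedge_def intro: dense_open_up)
  ultimately show "openin (subtopology (forcing_topology T) B) D"
    unfolding openin_subtopology by blast
  have "\<exists>y\<in>D. y \<in> U" if t: "t \<in> B" "t \<in> U" "openin (subtopology (forcing_topology T) B) U" for t U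
  proof -
    from t obtain V where V: "openin (forcing_topology T) V" "U = V \<inter> B"
      by (auto simp: openin_subtopology)
    obtain u where "u \<in> D" "t \<le> u"
      using assms(2) t(1) by (rule dense_openE)
    then show ?thesis
      using V t assms dense_open_subset[OF assms(2)] openin_forcing_topology_up[OF V(1)] by blast
  qed
  then show "subtopology (forcing_topology T) B closure_of D = B"
    using assms(1) by (auto simp: closure_of_def)
qed

lemma dense_open_Inter:
  assumes "B \<subseteq> T" "Baire_space (subtopology (forcing_topology T) B)"
    and "countable I" "\<And>i. i \<in> I \<Longrightarrow> dense_open B (D i)"
  shows "dense_open B {u\<in>B. \<forall>i\<in>I. u \<in> D i}"
proof (rule dense_openI)
  let ?X = "subtopology (forcing_topology T) B"
  have top: "topspace ?X = B"
    using assms(1) by auto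
  have "countable (D ` I)"
    using assms(3) by (rule countable_image)
  moreover have "\<forall>G\<in>D ` I. openin ?X G \<and> ?X closure_of G = B"
    using openin_dense_open[OF assms(1,4)] closure_of_dense_open[OF assms(1,4)] by simp
  ultimately have cl: "?X closure_of (B \<inter> \<Inter>(D ` I)) = B"
    using assms(2) unfolding Baire_space_def top by simp
  fix t assume t: "t \<in> B"
  have "openin ?X (wedge T t \<inter> B)"
    using t assms(1) openin_wedge by (auto simp: openin_subtopology)
  moreover have "t \<in> wedge T t \<inter> B"
    using t assms(1) by (auto simp: wedge_def)
  moreover have "t \<in> ?X closure_of (B \<inter> \<Inter>(D ` I))"
    unfolding cl by (rule t)
  ultimately obtain u where "u \<in> B \<inter> \<Inter>(D ` I)" "u \<in> wedge T t \<inter> B"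
    unfolding in_closure_of by blast
  then show "\<exists>u\<in>{u\<in>B. \<forall>i\<in>I. u \<in> D i}. t \<le> u"
    by (auto simp: wedge_def)
qed (use assms(4) in \<open>auto dest: dense_open_up\<close>)

text \<open>A weakly decreasing real function on a dense open set is constant above densely many points: for each
  \<open>\<epsilon>\<close>, going up far enough leaves room for a decrease of less than \<open>\<epsilon>\<close>.\<close>

lemma dense_open_eventually_const:
  fixes f :: "'a::order \<Rightarrow> real"
  assumes "B \<subseteq> T" "Baire_space (subtopology (forcing_topology T) B)" "dense_open B S"
    and anti: "\<And>u v. u \<in> S \<Longrightarrow> v \<in> S \<Longrightarrow> u \<le> v \<Longrightarrow> f v \<le> f u"
  shows "dense_open B {u\<in>S. \<forall>v\<in>B. u \<le> v \<longrightarrow> f v = f u}"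
proof -
  \<comment> \<open>Composing with \<open>arctan\<close> makes the function bounded without losing injectivity.\<close>
  define g where "g u = arctan (f u)" for u
  have g_anti: "g v \<le> g u" if "u \<in> S" "v \<in> S" "u \<le> v" for u v
    using anti[OF that] by (simp add: g_def arctan_le_iff)
  note up = dense_open_up[OF assms(3)] and sub = dense_open_subset[OF assms(3)]
  define D where "D n = {u\<in>S. \<forall>v\<in>B. u \<le> v \<longrightarrow> g u - g v < inverse (real (Suc n))}" for n
  have D_I: "u \<in> D n"
    if "u \<in> S" "\<And>v. v \<in> B \<Longrightarrow> u \<le> v \<Longrightarrow> g u - g v < inverse (real (Suc n))" for u n
    unfolding D_def using that by blast
  have D_S: "u \<in> S" if "u \<in> D n" for u n
    using that unfolding D_def by blast
  have D_less: "g u - g v < inverse (real (Suc n))" if "u \<in> D n" "v \<in> B" "u \<le> v" for u v n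
    using that unfolding D_def by blast
  have "dense_open B (D n)" for n
  proof (rule dense_openI)
    show "D n \<subseteq> B"
      using sub D_S by blast
    show "v \<in> D n" if "u \<in> D n" "v \<in> B" "u \<le> v" for u v
    proof (rule D_I)
      have "u \<in> S"
        using that(1) by (rule D_S)
      then show "v \<in> S"
        using that(2,3) by (rule up)
      fix w assume w: "w \<in> B" "v \<le> w"
      have "g u - g w < inverse (real (Suc n))"
        using that(1) w(1) order_trans[OF that(3) w(2)] by (rule D_less)
      with g_anti[OF \<open>u \<in> S\<close> \<open>v \<in> S\<close> that(3)] show "g v - g w < inverse (real (Suc n))"
        by linarith
    qed
    fix t assume "t \<in> B"
    with assms(3) obtain s where s: "s \<in> S" "t \<le> s"
      by (rule dense_openE)
    define A where "A = g ` {v\<in>B. s \<le> v}"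
    have "s \<in> B"
      using s(1) sub by (rule set_mp[rotated])
    then have "A \<noteq> {}"
      by (auto simp: A_def)
    have "bdd_below A"
      by (rule bdd_belowI[of _ "- (pi / 2)"]) (auto simp: A_def g_def intro: arctan_lbound less_imp_le)
    have "Inf A < Inf A + inverse (real (Suc n))"
      by simp
    from cInf_lessD[OF \<open>A \<noteq> {}\<close> this] obtain u where u: "u \<in> B" "s \<le> u" "g u < Inf A + inverse (real (Suc n))"
      by (auto simp: A_def)
    have "u \<in> D n"
    proof (rule D_I)
      show "u \<in> S"
        using s(1) u(1,2) by (rule up)
      fix v assume "v \<in> B" "u \<le> v"
      then have "g v \<in> A"
        using order_trans[OF u(2)] by (auto simp: A_def)
      then have "Inf A \<le> g v"
        using \<open>bdd_below A\<close> by (rule cInf_lower)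
      with u(3) show "g u - g v < inverse (real (Suc n))"
        by linarith
    qed
    then show "\<exists>u\<in>D n. t \<le> u"
      using order_trans[OF s(2) u(2)] by blast
  qed
  then have dense: "dense_open B {u\<in>B. \<forall>n\<in>UNIV. u \<in> D n}"
    by (intro dense_open_Inter[OF assms(1,2)]) auto
  have const: "f v = f u" if "\<forall>n. u \<in> D n" "v \<in> B" "u \<le> v" for u v
  proof (rule ccontr)
    assume "f v \<noteq> f u"
    have "u \<in> S"
      using that(1) D_S by blast
    then have "v \<in> S"
      using that(2,3) by (rule up)
    have "f v < f u"
      using anti[OF \<open>u \<in> S\<close> \<open>v \<in> S\<close> that(3)] \<open>f v \<noteq> f u\<close> by linarith
    then have "g v < g u"
      by (simp add: g_def arctan_less_iff)
    then obtain n where "inverse (real (Suc n)) < g u - g v"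
      using reals_Archimedean[of "g u - g v"] by auto
    moreover have "g u - g v < inverse (real (Suc n))"
      using that(1)[rule_format] that(2,3) by (rule D_less)
    ultimately show False
      by linarith
  qed
  show ?thesis
  proof (rule dense_openI)
    show "{u\<in>S. \<forall>v\<in>B. u \<le> v \<longrightarrow> f v = f u} \<subseteq> B"
      using sub by blast
    show "v \<in> {u\<in>S. \<forall>v\<in>B. u \<le> v \<longrightarrow> f v = f u}"
      if u: "u \<in> {u\<in>S. \<forall>v\<in>B. u \<le> v \<longrightarrow> f v = f u}" and v: "v \<in> B" "u \<le> v" for u v
    proof -
      have "u \<in> S" and eq: "\<And>w. w \<in> B \<Longrightarrow> u \<le> w \<Longrightarrow> f w = f u"
        using u by blast+
      have "f w = f v" if "w \<in> B" "v \<le> w" for w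
        using eq[OF that(1) order_trans[OF v(2) that(2)]] eq[OF v] by (rule trans[OF _ sym])
      with up[OF \<open>u \<in> S\<close> v] show ?thesis
        by blast
    qed
    fix t assume "t \<in> B"
    with dense obtain u where "u \<in> {u\<in>B. \<forall>n\<in>UNIV. u \<in> D n}" "t \<le> u"
      by (rule dense_openE)
    then have u: "t \<le> u" "\<forall>n. u \<in> D n"
      by blast+
    have "u \<in> S"
      using u(2) D_S by blast
    moreover have "f v = f u" if "v \<in> B" "u \<le> v" for v
      using u(2) that by (rule const)
    ultimately show "\<exists>u\<in>{u\<in>S. \<forall>v\<in>B. u \<le> v \<longrightarrow> f v = f u}. t \<le> u"
      using u(1) by blast
  qed
qed

section \<open>Settled entries\<close>

text \<open>The points of \<open>B\<close> above which \<open>\<rho>\<close> always has an entry at \<open>\<alpha>\<close>, and no longer changes the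
  entries up to and including the one at \<open>\<alpha>\<close>.\<close>

definition settled :: "('a::order \<Rightarrow> Z) \<Rightarrow> 'a set \<Rightarrow> omega1 \<Rightarrow> 'a set" where
  "settled \<rho> B \<alpha> = {u\<in>B. \<forall>v\<in>B. u \<le> v \<longrightarrow>
     \<alpha> \<le> last_index (\<rho> v) \<and> (\<forall>\<xi>\<le>\<alpha>. entry (\<rho> v) \<xi> = entry (\<rho> u) \<xi>)}"

lemma settledI:
  assumes "u \<in> B" "\<And>v. v \<in> B \<Longrightarrow> u \<le> v \<Longrightarrow> \<alpha> \<le> last_index (\<rho> v)"
    and "\<And>v \<xi>. v \<in> B \<Longrightarrow> u \<le> v \<Longrightarrow> \<xi> \<le> \<alpha> \<Longrightarrow> entry (\<rho> v) \<xi> = entry (\<rho> u) \<xi>"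
  shows "u \<in> settled \<rho> B \<alpha>"
  unfolding settled_def
proof (intro CollectI conjI ballI impI allI)
  show "u \<in> B"
    by (fact assms(1))
  fix v assume v: "v \<in> B" "u \<le> v"
  then show "\<alpha> \<le> last_index (\<rho> v)"
    by (rule assms(2))
  fix \<xi> assume "\<xi> \<le> \<alpha>"
  with v show "entry (\<rho> v) \<xi> = entry (\<rho> u) \<xi>"
    by (rule assms(3))
qed

lemma settled_subset: "settled \<rho> B \<alpha> \<subseteq> B"
  unfolding settled_def by blast

lemma settled_last_index_le:
  "u \<in> settled \<rho> B \<alpha> \<Longrightarrow> v \<in> B \<Longrightarrow> u \<le> v \<Longrightarrow> \<alpha> \<le> last_index (\<rho> v)"
  unfolding settled_def by blast

lemma settled_last_index: "u \<in> settled \<rho> B \<alpha> \<Longrightarrow> \<alpha> \<le> last_index (\<rho> u)"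
  using settled_subset by (blast intro: settled_last_index_le)

lemma settled_entry:
  "u \<in> settled \<rho> B \<alpha> \<Longrightarrow> v \<in> B \<Longrightarrow> u \<le> v \<Longrightarrow> \<xi> \<le> \<alpha> \<Longrightarrow> entry (\<rho> v) \<xi> = entry (\<rho> u) \<xi>"
  unfolding settled_def by blast

lemma settled_up:
  assumes "u \<in> settled \<rho> B \<alpha>" "v \<in> B" "u \<le> v"
  shows "v \<in> settled \<rho> B \<alpha>"
proof (rule settledI)
  show "v \<in> B"
    by (fact assms(2))
  fix w assume w: "w \<in> B" "v \<le> w"
  then have "u \<le> w"
    using assms(3) by simp
  show "\<alpha> \<le> last_index (\<rho> w)"
    using assms(1) w(1) \<open>u \<le> w\<close> by (rule settled_last_index_le)
  fix \<xi> assume "\<xi> \<le> \<alpha>"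
  then have "entry (\<rho> w) \<xi> = entry (\<rho> u) \<xi>" "entry (\<rho> v) \<xi> = entry (\<rho> u) \<xi>"
    using settled_entry[OF assms(1)] w(1) \<open>u \<le> w\<close> assms(2,3) by blast+
  then show "entry (\<rho> w) \<xi> = entry (\<rho> v) \<xi>"
    by simp
qed

lemma settled_antimono:
  assumes "\<xi> \<le> \<alpha>"
  shows "settled \<rho> B \<alpha> \<subseteq> settled \<rho> B \<xi>"
proof
  fix u assume u: "u \<in> settled \<rho> B \<alpha>"
  show "u \<in> settled \<rho> B \<xi>"
  proof (rule settledI)
    show "u \<in> B"
      using u settled_subset by blast
    fix v assume v: "v \<in> B" "u \<le> v"
    show "\<xi> \<le> last_index (\<rho> v)"
      using assms settled_last_index_le[OF u v] by (rule order_trans)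
    fix \<eta> assume "\<eta> \<le> \<xi>"
    then show "entry (\<rho> v) \<eta> = entry (\<rho> u) \<eta>"
      using settled_entry[OF u v] assms by simp
  qed
qed

lemma dense_open_settled:
  fixes \<rho> :: "'a::order \<Rightarrow> Z"
  assumes "B \<subseteq> T" "Baire_space (subtopology (forcing_topology T) B)"
    and mono: "\<And>s t. s \<in> B \<Longrightarrow> t \<in> B \<Longrightarrow> s \<le> t \<Longrightarrow> \<rho> s \<le> \<rho> t"
    and incr: "\<And>t. t \<in> B \<Longrightarrow> \<exists>u\<in>B. t \<le> u \<and> \<rho> t < \<rho> u"
  shows "dense_open B (settled \<rho> B \<alpha>)"
proof (induction \<alpha> rule: less_induct)
  case (less \<alpha>)
  define P where "P = {u\<in>B. \<forall>\<xi>\<in>{..<\<alpha>}. u \<in> settled \<rho> B \<xi>}"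
  have P: "dense_open B P"
    unfolding P_def using less countable_lessThan_omega1
    by (intro dense_open_Inter[OF assms(1,2)]) auto
  have P_entry: "entry (\<rho> w) \<xi> = entry (\<rho> v) \<xi>" if "v \<in> P" "w \<in> B" "v \<le> w" "\<xi> < \<alpha>" for v w \<xi>
  proof (rule settled_entry[of v \<rho> B \<xi>])
    show "v \<in> settled \<rho> B \<xi>"
      using that by (simp add: P_def)
  qed (use that in simp_all)
  define S where "S = {u\<in>P. \<forall>v\<in>B. u \<le> v \<longrightarrow> \<alpha> \<le> last_index (\<rho> v)}"
  have S: "dense_open B S"
  proof (rule dense_openI)
    show "S \<subseteq> B"
      by (auto simp: S_def P_def)
    show "v \<in> S" if "u \<in> S" "v \<in> B" "u \<le> v" for u v
    proof -
      have "u \<in> P" and last: "\<And>w. w \<in> B \<Longrightarrow> u \<le> w \<Longrightarrow> \<alpha> \<le> last_index (\<rho> w)"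
        using that(1) unfolding S_def by blast+
      have "v \<in> P"
        using P \<open>u \<in> P\<close> that(2,3) by (rule dense_open_up)
      moreover have "\<alpha> \<le> last_index (\<rho> w)" if "w \<in> B" "v \<le> w" for w
        using that(1) order_trans[OF \<open>u \<le> v\<close> that(2)] by (rule last)
      ultimately show ?thesis
        by (simp add: S_def)
    qed
    fix t assume "t \<in> B"
    with P obtain s where s: "s \<in> P" "t \<le> s"
      by (rule dense_openE)
    then have "s \<in> B"
      by (simp add: P_def)
    \<comment> \<open>If the sequence at \<open>s\<close> is too short, then a larger one above \<open>s\<close> strictly extends it. Its
      last index cannot be below \<open>\<alpha>\<close>, since \<open>s\<close> settles the entry at every index below \<open>\<alpha>\<close>
      and hence has an entry there.\<close>
    have "\<exists>u\<in>B. s \<le> u \<and> \<alpha> \<le> last_index (\<rho> u)"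
    proof (cases "\<alpha> \<le> last_index (\<rho> s)")
      case False
      obtain u where u: "u \<in> B" "s \<le> u" "\<rho> s < \<rho> u"
        using incr[OF \<open>s \<in> B\<close>] by blast
      have "entry (\<rho> u) \<xi> = entry (\<rho> s) \<xi>" if "\<xi> \<le> last_index (\<rho> s)" for \<xi>
        using that False by (intro P_entry[OF s(1) u(1,2)]) simp
      then have "\<not> entry (\<rho> u) \<xi> < entry (\<rho> s) \<xi>" if "\<xi> \<le> last_index (\<rho> s)" for \<xi>
        using that by simp
      then have ext: "strictly_extends (\<rho> u) (\<rho> s)"
        using u(3) unfolding less_Z_def by blast
      have "\<alpha> \<le> last_index (\<rho> u)"
      proof (rule ccontr)
        assume "\<not> \<alpha> \<le> last_index (\<rho> u)"
        then have "s \<in> settled \<rho> B (last_index (\<rho> u))"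
          using s by (auto simp: P_def)
        then have "last_index (\<rho> u) \<le> last_index (\<rho> s)"
          by (rule settled_last_index)
        with ext show False
          unfolding strictly_extends_def using leD by blast
      qed
      with u show ?thesis by blast
    qed (use \<open>s \<in> B\<close> in auto)
    then obtain u where u: "u \<in> B" "s \<le> u" "\<alpha> \<le> last_index (\<rho> u)"
      by blast
    have "u \<in> P"
      using dense_open_up[OF P] s u by blast
    \<comment> \<open>Above \<open>u\<close> the sequences stay this long: one too short would be strictly extended by that
      at \<open>u\<close>, against monotonicity.\<close>
    have "\<alpha> \<le> last_index (\<rho> v)" if v: "v \<in> B" "u \<le> v" for v
    proof (rule ccontr)
      assume *: "\<not> \<alpha> \<le> last_index (\<rho> v)"
      have "entry (\<rho> v) \<xi> = entry (\<rho> u) \<xi>" if "\<xi> \<le> last_index (\<rho> v)" for \<xi>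
        using * that by (intro P_entry[OF \<open>u \<in> P\<close> v]) simp
      with * u(3) have "strictly_extends (\<rho> u) (\<rho> v)"
        by (simp add: strictly_extends_def)
      then have "\<rho> v < \<rho> u"
        by (simp add: less_Z_def)
      with mono[OF u(1) v] show False
        by simp
    qed
    then have "u \<in> S"
      using \<open>u \<in> P\<close> by (auto simp: S_def)
    with order_trans[OF s(2) u(2)] show "\<exists>u\<in>S. t \<le> u"
      by blast
  qed
  have S_D: "u \<in> P" "u \<in> B" "\<alpha> \<le> last_index (\<rho> u)" if "u \<in> S" for u
    using that by (auto simp: S_def P_def)
  have "entry (\<rho> v) \<alpha> \<le> entry (\<rho> u) \<alpha>" if "u \<in> S" "v \<in> S" "u \<le> v" for u v
  proof (rule ccontr)
    assume "\<not> entry (\<rho> v) \<alpha> \<le> entry (\<rho> u) \<alpha>"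
    moreover have "\<forall>\<xi><\<alpha>. entry (\<rho> v) \<xi> = entry (\<rho> u) \<xi>"
      using P_entry[OF S_D(1)[OF that(1)] S_D(2)[OF that(2)] that(3)] by blast
    ultimately have "\<rho> v < \<rho> u"
      unfolding less_Z_def using S_D(3) that(1,2) by (intro disjI2 exI[of _ \<alpha>]) simp
    with mono[OF S_D(2) S_D(2) that(3)] that(1,2) show False
      by simp
  qed
  then have dense: "dense_open B {u\<in>S. \<forall>v\<in>B. u \<le> v \<longrightarrow> entry (\<rho> v) \<alpha> = entry (\<rho> u) \<alpha>}"
    by (rule dense_open_eventually_const[OF assms(1,2) S])
  have eq: "{u\<in>S. \<forall>v\<in>B. u \<le> v \<longrightarrow> entry (\<rho> v) \<alpha> = entry (\<rho> u) \<alpha>} = settled \<rho> B \<alpha>"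
  proof (intro equalityI subsetI)
    fix u assume "u \<in> {u\<in>S. \<forall>v\<in>B. u \<le> v \<longrightarrow> entry (\<rho> v) \<alpha> = entry (\<rho> u) \<alpha>}"
    then have "u \<in> S" and const: "\<And>v. v \<in> B \<Longrightarrow> u \<le> v \<Longrightarrow> entry (\<rho> v) \<alpha> = entry (\<rho> u) \<alpha>"
      by blast+
    show "u \<in> settled \<rho> B \<alpha>"
    proof (rule settledI)
      show "u \<in> B"
        using \<open>u \<in> S\<close> by (rule S_D)
      fix v assume v: "v \<in> B" "u \<le> v"
      show "\<alpha> \<le> last_index (\<rho> v)"
        using dense_open_up[OF S \<open>u \<in> S\<close> v] by (rule S_D)
      fix \<xi> assume "\<xi> \<le> \<alpha>"
      then consider "\<xi> < \<alpha>" | "\<xi> = \<alpha>"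
        by (auto simp: le_less)
      then show "entry (\<rho> v) \<xi> = entry (\<rho> u) \<xi>"
      proof cases
        case 1
        with S_D(1)[OF \<open>u \<in> S\<close>] v show ?thesis
          by (rule P_entry)
      next
        case 2
        with const[OF v] show ?thesis
          by simp
      qed
    qed
  next
    fix u assume u: "u \<in> settled \<rho> B \<alpha>"
    then have "u \<in> B"
      using settled_subset by blast
    moreover have "u \<in> settled \<rho> B \<xi>" if "\<xi> < \<alpha>" for \<xi>
      using u settled_antimono[OF less_imp_le[OF that]] by blast
    ultimately have "u \<in> P"
      by (simp add: P_def)
    moreover have "\<alpha> \<le> last_index (\<rho> v)" if "v \<in> B" "u \<le> v" for v
      using settled_up[OF u that] by (rule settled_last_index)
    ultimately have "u \<in> S"
      by (simp add: S_def)
    moreover have "entry (\<rho> v) \<alpha> = entry (\<rho> u) \<alpha>" if "v \<in> B" "u \<le> v" for v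
      using u that order_refl by (rule settled_entry)
    ultimately show "u \<in> {u\<in>S. \<forall>v\<in>B. u \<le> v \<longrightarrow> entry (\<rho> v) \<alpha> = entry (\<rho> u) \<alpha>}"
      by blast
  qed
  show ?case
    using dense unfolding eq .
qed

section \<open>No strictly increasing sequence of reals has uncountable length\<close>

lemma entry_mono: "\<xi> \<le> \<eta> \<Longrightarrow> \<eta> \<le> last_index x \<Longrightarrow> entry x \<xi> \<le> entry x \<eta>"
  using Rep_Z[of x] by (auto simp: entry_def last_index_def mono_on_def)

lemma entry_strict_mono: "\<xi> < \<eta> \<Longrightarrow> \<eta> < last_index x \<Longrightarrow> entry x \<xi> < entry x \<eta>"
  using Rep_Z[of x] by (auto simp: entry_def last_index_def strict_mono_on_def)

lemma countable_bounded_omega1: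
  fixes A :: "omega1 set"
  assumes "countable A"
  shows "\<exists>b. \<forall>a\<in>A. a < b"
proof -
  have "countable (\<Union>a\<in>A. insert a {..<a})"
    using assms countable_lessThan_omega1 by auto
  then have "(\<Union>a\<in>A. insert a {..<a}) \<noteq> UNIV"
    using uncountable_UNIV_omega1 by auto
  then obtain b where "b \<notin> (\<Union>a\<in>A. insert a {..<a})"
    by blast
  then have "\<forall>a\<in>A. a < b"
    by (auto simp: neq_iff)
  then show ?thesis ..
qed

text \<open>Here \<open>D q\<close> is the set of points that decide whether some settled entry exceeds \<open>q\<close>; this
  replaces the collapse of \<open>\<omega>\<^sub>1\<close> that an \<open>\<omega>\<^sub>1\<close>-sequence of reals along a generic branch would
  give.\<close>

lemma settled_not_dense_open:
  fixes \<rho> :: "'a::order \<Rightarrow> Z"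
  assumes "B \<subseteq> T" "Baire_space (subtopology (forcing_topology T) B)" "B \<noteq> {}"
  shows "\<exists>\<alpha>. \<not> dense_open B (settled \<rho> B \<alpha>)"
proof (rule ccontr)
  assume "\<not> ?thesis"
  then have dense: "dense_open B (settled \<rho> B \<alpha>)" for \<alpha>
    by blast
  define above where
    "above q \<alpha> = {u \<in> settled \<rho> B \<alpha>. of_rat q < entry (\<rho> u) \<alpha>}" for q \<alpha>
  have above_up: "v \<in> above q \<alpha>" if "u \<in> above q \<alpha>" "v \<in> B" "u \<le> v" for q \<alpha> u v
  proof -
    have u: "u \<in> settled \<rho> B \<alpha>" "of_rat q < entry (\<rho> u) \<alpha>"
      using that(1) by (simp_all add: above_def)
    then have "entry (\<rho> v) \<alpha> = entry (\<rho> u) \<alpha>"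
      using settled_entry[OF u(1) that(2,3)] by blast
    with u settled_up[OF u(1) that(2,3)] show ?thesis
      by (simp add: above_def)
  qed
  define D where "D q = {u\<in>B. (\<exists>\<alpha>. u \<in> above q \<alpha>) \<or> (\<forall>v\<in>B. u \<le> v \<longrightarrow> (\<forall>\<alpha>. v \<notin> above q \<alpha>))}" for q
  have "dense_open B (D q)" for q
  proof (rule dense_openI)
    show "D q \<subseteq> B"
      by (auto simp: D_def)
    show "v \<in> D q" if u: "u \<in> D q" and v: "v \<in> B" "u \<le> v" for u v
    proof -
      consider \<alpha> where "u \<in> above q \<alpha>" | "\<And>w \<alpha>. w \<in> B \<Longrightarrow> u \<le> w \<Longrightarrow> w \<notin> above q \<alpha>"
        using u unfolding D_def by blast
      then show ?thesis
      proof cases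
        case 1
        with above_up[OF 1 v] v(1) show ?thesis
          unfolding D_def by blast
      next
        case 2
        have "w \<notin> above q \<alpha>" if "w \<in> B" "v \<le> w" for w \<alpha>
          using that(1) order_trans[OF v(2) that(2)] by (rule 2)
        with v(1) show ?thesis
          unfolding D_def by blast
      qed
    qed
    show "\<exists>u\<in>D q. t \<le> u" if "t \<in> B" for t
    proof (cases "\<exists>v\<in>B. t \<le> v \<and> (\<exists>\<alpha>. v \<in> above q \<alpha>)")
      case True
      then show ?thesis
        unfolding D_def by blast
    next
      case False
      with that have "t \<in> D q"
        unfolding D_def by blast
      then show ?thesis
        by blast
    qed
  qed
  then have "dense_open B {u\<in>B. \<forall>q\<in>UNIV. u \<in> D q}"
    by (intro dense_open_Inter[OF assms(1,2)]) auto
  moreover obtain t where "t \<in> B"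
    using assms(3) by blast
  ultimately obtain u where "u \<in> {u\<in>B. \<forall>q\<in>UNIV. u \<in> D q}"
    by (rule dense_openE)
  then have u: "u \<in> B" "\<And>q. u \<in> D q"
    by blast+
  \<comment> \<open>The index \<open>i q\<close> is arbitrary if no settled entry at \<open>u\<close> exceeds \<open>q\<close>.\<close>
  define i where "i q = (SOME \<alpha>. u \<in> above q \<alpha>)" for q
  obtain \<alpha> where \<alpha>: "\<forall>q. i q < \<alpha>"
    using countable_bounded_omega1[of "range i"] by auto
  \<comment> \<open>Strict monotonicity holds below the last index only, hence the third ordinal \<open>\<gamma>\<close>.\<close>
  obtain \<beta> where "\<alpha> < \<beta>"
    using countable_bounded_omega1[of "{\<alpha>}"] by auto
  obtain \<gamma> where "\<beta> < \<gamma>"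
    using countable_bounded_omega1[of "{\<beta>}"] by auto
  obtain v where v: "v \<in> settled \<rho> B \<gamma>" "u \<le> v"
    using dense u(1) by (rule dense_openE)
  have "v \<in> B"
    using v settled_subset by blast
  have "\<beta> < last_index (\<rho> v)"
    using settled_last_index[OF v(1)] \<open>\<beta> < \<gamma>\<close> by simp
  then have "entry (\<rho> v) \<alpha> < entry (\<rho> v) \<beta>"
    using \<open>\<alpha> < \<beta>\<close> by (rule entry_strict_mono[rotated])
  from of_rat_dense[OF this] obtain q
    where q: "entry (\<rho> v) \<alpha> < of_rat q" "of_rat q < entry (\<rho> v) \<beta>"
    by blast
  have "v \<in> settled \<rho> B \<beta>"
    using v(1) settled_antimono[OF less_imp_le[OF \<open>\<beta> < \<gamma>\<close>]] by blast
  then have "v \<in> above q \<beta>"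
    using q by (simp add: above_def)
  then have "\<exists>\<alpha>. u \<in> above q \<alpha>"
    using u(2)[of q] v(2) \<open>v \<in> B\<close> unfolding D_def by blast
  then have "u \<in> above q (i q)"
    unfolding i_def by (rule someI_ex)
  then have "v \<in> above q (i q)"
    using \<open>v \<in> B\<close> v(2) by (rule above_up)
  then have "of_rat q < entry (\<rho> v) (i q)"
    by (simp add: above_def)
  also have "\<dots> \<le> entry (\<rho> v) \<alpha>"
    using \<alpha>[rule_format, of q] \<open>\<alpha> < \<beta>\<close> \<open>\<beta> < last_index (\<rho> v)\<close> by (intro entry_mono) auto
  finally show False
    using q by simp
qed

section \<open>Ever-branching Baire subsets\<close>

lemma ever_branching_wedge:
  assumes "ever_branching B" "t \<in> B"
  shows "ever_branching (wedge B t)"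
  unfolding ever_branching_def
proof (intro conjI ballI)
  show "wedge B t \<noteq> {}"
    using assms(2) by (auto simp: wedge_def)
  fix s assume "s \<in> wedge B t"
  then have s: "s \<in> B" "t \<le> s"
    by (simp_all add: wedge_def)
  then obtain u v where uv: "u \<in> B" "v \<in> B" "s < u" "s < v" "\<not> u \<le> v" "\<not> v \<le> u"
    using assms(1) unfolding ever_branching_def by blast
  have "u \<in> wedge B t" "v \<in> wedge B t"
    using uv(1-4) order.strict_trans1[OF s(2)] by (simp_all add: wedge_def less_imp_le)
  with uv(3-) show "\<exists>u\<in>wedge B t. \<exists>v\<in>wedge B t. s < u \<and> s < v \<and> \<not> u \<le> v \<and> \<not> v \<le> u"
    by blast
qed

theorem proposition3:
  fixes T :: "'a::order set" and \<rho> :: "'a \<Rightarrow> Z"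
  assumes "tree T"
    and "\<forall>s\<in>T. \<forall>t\<in>T. s < t \<longrightarrow> \<rho> s \<le> \<rho> t"
    and "\<forall>E\<subseteq>T. ever_branching E \<longrightarrow> \<not> \<rho> constant_on E"
  shows "\<not> (\<exists>B\<subseteq>T. ever_branching B \<and> Baire_subset T B)"
proof
  assume "\<exists>B\<subseteq>T. ever_branching B \<and> Baire_subset T B"
  then obtain B where B: "B \<subseteq> T" "ever_branching B"
    and Baire: "Baire_space (subtopology (forcing_topology T) B)"
    unfolding Baire_subset_def by blast
  have mono: "\<rho> s \<le> \<rho> t" if "s \<in> B" "t \<in> B" "s \<le> t" for s t
  proof (cases "s = t")
    case False
    with that(3) have "s < t"
      by simp
    with that(1,2) B(1) assms(2) show ?thesis
      by blast
  qed simp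
  have incr: "\<exists>u\<in>B. t \<le> u \<and> \<rho> t < \<rho> u" if "t \<in> B" for t
  proof -
    have "wedge B t \<subseteq> T"
      using B(1) by (auto simp: wedge_def)
    then have "\<not> \<rho> constant_on wedge B t"
      using assms(3) ever_branching_wedge[OF B(2) that] by blast
    then have "\<not> (\<forall>u\<in>wedge B t. \<rho> u = \<rho> t)"
      unfolding constant_on_def by (rule contrapos_nn) (rule exI)
    then obtain u where "u \<in> wedge B t" "\<rho> u \<noteq> \<rho> t"
      by blast
    then have u: "u \<in> B" "t \<le> u"
      by (simp_all add: wedge_def)
    with mono[OF that u] \<open>\<rho> u \<noteq> \<rho> t\<close> have "\<rho> t < \<rho> u"
      by simp
    with u show ?thesis
      by blast
  qed
  have "dense_open B (settled \<rho> B \<alpha>)" for \<alpha>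
    using B(1) Baire mono incr by (rule dense_open_settled)
  moreover have "B \<noteq> {}"
    using B(2) by (simp add: ever_branching_def)
  ultimately show False
    using settled_not_dense_open[OF B(1) Baire] by blast
qed

end
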